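(* Let $u(s)=\sum_{k=1}^2\big(a_k\cos(2\phi_ks)+b_k\sin(2\phi_ks)\big)$ be a strictly normal control, that is: $a_1,b_1,a_2,b_2\in\mathbb{R}^4$ are pairwise orthogonal, $|a_k|=|b_k|=r_k>0$ for $k=1,2$, and $\phi_1>\phi_2\ge0$. Let $\gamma(\cdot,a,b,\phi)$ be the corresponding trajectory. Then there is a sequence $s_j\to+\infty$ such that $\gamma(s_j,a,b,\phi)\in C_4$ for all $j\in\mathbb{N}$.
   Context: The trajectory $\gamma(\cdot,a,b,\phi)=(x,t)$ of a control $u$ is the solution in $\mathbb{R}^4\times\Lambda^2\mathbb{R}^4$ of $\dot x=u$, $\dot t=\frac12x\wedge u$ with $(x(0),t(0))=(0,0)$. The set $C_4\subset\mathbb{R}^4\times\Lambda^2\mathbb{R}^4$ is $C_4=\Sigma_1\cup\Sigma_2\cup\Sigma_3$, where, with $u_1,u_2,u_3,u_4$ ranging over all orthonormal families in $\mathbb{R}^4$, $$\Sigma_1=\{(x_1u_1+x_2u_2,\ \lambda_1u_1\wedge u_2+\lambda_2u_3\wedge u_4):\lambda_1,\lambda_2>0,\ \lambda_1\ne\lambda_2,\ (x_1,x_2)\in\mathbb{R}^2\},$$ $$\Sigma_2=\{(x,\ \lambda(u_1\wedge u_2+u_3\wedge u_4)):\lambda>0,\ x\in\mathbb{R}^4\},$$ $$\Sigma_3=\{(x_1u_1,\ \lambda u_3\wedge u_4):\lambda>0,\ x_1\in\mathbb{R}\}.$$ *)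

theory Defs
  imports "HOL-Analysis.Analysis"
begin

text \<open>\<open>\<Lambda>\<^sup>2 \<real>\<^sup>4\<close> is identified with the skew-symmetric matrices inside \<open>real^4^4\<close>, via
  \<open>v \<and> w = v w\<^sup>T - w v\<^sup>T\<close>. Every second component occurring below is a linear combination, or an
  integral, of such matrices, so the ambient matrix space adds nothing.\<close>

definition wedge :: "real^4 \<Rightarrow> real^4 \<Rightarrow> real^4^4" (infixl "\<and>\<^sub>w" 75) where
  "v \<and>\<^sub>w w = (\<chi> i j. v $ i * w $ j - v $ j * w $ i)"

definition control :: "(nat \<Rightarrow> real^4) \<Rightarrow> (nat \<Rightarrow> real^4) \<Rightarrow> (nat \<Rightarrow> real) \<Rightarrow> real \<Rightarrow> real^4" where
  "control a b \<phi> s = (\<Sum>k=1..2. cos (2 * \<phi> k * s) *\<^sub>R a k + sin (2 * \<phi> k * s) *\<^sub>R b k)"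

text \<open>Solutions are taken on the whole real line, where the controls are defined. For continuous \<open>u\<close>
  exactly one exists, see \<open>trajectory_exists_unique\<close>.\<close>

definition trajectory :: "(real \<Rightarrow> real^4) \<Rightarrow> (real \<Rightarrow> (real^4) \<times> (real^4^4)) \<Rightarrow> bool" where
  "trajectory u \<gamma> \<longleftrightarrow> \<gamma> 0 = (0, 0) \<and>
     (\<forall>s. (\<gamma> has_vector_derivative (u s, (1/2) *\<^sub>R (fst (\<gamma> s) \<and>\<^sub>w u s))) (at s))"

definition orthonormal_family :: "(nat \<Rightarrow> real^4) \<Rightarrow> bool" where
  "orthonormal_family u \<longleftrightarrow>
     (\<forall>i\<in>{1..4}. \<forall>j\<in>{1..4}. u i \<bullet> u j = (if i = j then 1 else 0))"

definition \<Sigma>\<^sub>1 :: "((real^4) \<times> (real^4^4)) set" where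
  "\<Sigma>\<^sub>1 = {(x\<^sub>1 *\<^sub>R u 1 + x\<^sub>2 *\<^sub>R u 2, \<mu>\<^sub>1 *\<^sub>R (u 1 \<and>\<^sub>w u 2) + \<mu>\<^sub>2 *\<^sub>R (u 3 \<and>\<^sub>w u 4)) | u x\<^sub>1 x\<^sub>2 \<mu>\<^sub>1 \<mu>\<^sub>2.
     orthonormal_family u \<and> \<mu>\<^sub>1 > 0 \<and> \<mu>\<^sub>2 > 0 \<and> \<mu>\<^sub>1 \<noteq> \<mu>\<^sub>2}"

definition \<Sigma>\<^sub>2 :: "((real^4) \<times> (real^4^4)) set" where
  "\<Sigma>\<^sub>2 = {(x, \<mu> *\<^sub>R (u 1 \<and>\<^sub>w u 2 + u 3 \<and>\<^sub>w u 4)) | u x \<mu>. orthonormal_family u \<and> \<mu> > 0}"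

definition \<Sigma>\<^sub>3 :: "((real^4) \<times> (real^4^4)) set" where
  "\<Sigma>\<^sub>3 = {(x\<^sub>1 *\<^sub>R u 1, \<mu> *\<^sub>R (u 3 \<and>\<^sub>w u 4)) | u x\<^sub>1 \<mu>. orthonormal_family u \<and> \<mu> > 0}"

definition C\<^sub>4 :: "((real^4) \<times> (real^4^4)) set" where
  "C\<^sub>4 = \<Sigma>\<^sub>1 \<union> \<Sigma>\<^sub>2 \<union> \<Sigma>\<^sub>3"

lemma continuous_on_wedge:
  assumes "continuous_on S f" "continuous_on S g"
  shows "continuous_on S (\<lambda>s. f s \<and>\<^sub>w g s)"
  unfolding wedge_def using assms by (intro continuous_intros)

lemma antiderivative_on_reals:
  fixes f :: "real \<Rightarrow> 'a::euclidean_space"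
  assumes "continuous_on UNIV f"
  obtains F where "F 0 = 0" "\<And>s. (F has_vector_derivative f s) (at s)"
proof -
  obtain G where G: "\<And>s. (G has_vector_derivative f s) (at s)"
    using einterval_antiderivative[of "-\<infinity>" "\<infinity>" f] assms
    by (auto simp: continuous_on_eq_continuous_at)
  have "((\<lambda>s. G s - G 0) has_vector_derivative f s) (at s)" for s
    using has_vector_derivative_diff[OF G has_vector_derivative_const[of "G 0"]] by simp
  then show ?thesis by (intro that[of "\<lambda>s. G s - G 0"]) auto
qed

lemma antiderivative_on_reals_unique:
  fixes F G :: "real \<Rightarrow> 'a::euclidean_space"
  assumes "F 0 = G 0"
    and "\<And>s. (F has_vector_derivative f s) (at s)" "\<And>s. (G has_vector_derivative f s) (at s)"
  shows "F = G"
proof -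
  have "((\<lambda>s. F s - G s) has_vector_derivative 0) (at s within UNIV)" for s
    using has_vector_derivative_diff[OF assms(2,3)] by simp
  then obtain c where "\<And>s. F s - G s = c"
    using has_vector_derivative_zero_constant[of UNIV "\<lambda>s. F s - G s"] by auto
  then show ?thesis using assms(1) by (metis eq_iff_diff_eq_0 ext)
qed

lemma trajectory_exists_unique:
  assumes u: "continuous_on UNIV u"
  shows "\<exists>!\<gamma>. trajectory u \<gamma>"
proof -
  obtain x where x: "x 0 = 0" "\<And>s. (x has_vector_derivative u s) (at s)"
    using antiderivative_on_reals[OF u] by blast
  have cx: "continuous_on UNIV x"
    using x(2) by (meson continuous_at_imp_continuous_on has_vector_derivative_continuous)
  obtain t where t: "t 0 = 0"
    "\<And>s. (t has_vector_derivative (1/2) *\<^sub>R (x s \<and>\<^sub>w u s)) (at s)"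
    using antiderivative_on_reals[of "\<lambda>s. (1/2) *\<^sub>R (x s \<and>\<^sub>w u s)"]
      continuous_on_scaleR[OF continuous_on_const continuous_on_wedge[OF cx u]] by blast
  have ex: "trajectory u (\<lambda>s. (x s, t s))"
    unfolding trajectory_def using x t by (auto intro!: has_vector_derivative_Pair)
  have "\<gamma> = (\<lambda>s. (x s, t s))" if "trajectory u \<gamma>" for \<gamma>
  proof -
    have d: "(\<gamma> has_vector_derivative (u s, (1/2) *\<^sub>R (fst (\<gamma> s) \<and>\<^sub>w u s))) (at s)" for s
      using that by (simp add: trajectory_def)
    have "((\<lambda>s. fst (\<gamma> s)) has_vector_derivative u s) (at s)" for s
      using bounded_linear.has_vector_derivative[OF bounded_linear_fst d[of s]] by simp
    then have "(\<lambda>s. fst (\<gamma> s)) = x"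
      using that x by (intro antiderivative_on_reals_unique) (auto simp: trajectory_def)
    then have "fst (\<gamma> s) = x s" for s by (rule fun_cong)
    then show ?thesis
      using that ex d
      by (intro antiderivative_on_reals_unique[where f = "\<lambda>s. (u s, (1/2) *\<^sub>R (x s \<and>\<^sub>w u s))"])
        (auto simp: trajectory_def)
  qed
  with ex show ?thesis by blast
qed

lemma continuous_on_control: "continuous_on S (control a b \<phi>)"
  unfolding control_def by (intro continuous_intros)

end

theory Submission
  imports Defs "HOL-Analysis.Kronecker_Approximation_Theorem"
begin

text \<open>
  Write \<open>p = \<phi> 1\<close> and \<open>q = \<phi> 2\<close>, so that \<open>p > q \<ge> 0\<close>. For every \<open>s\<close>, the control restricted to
  \<open>[0, s]\<close> is invariant under time reversal about the midpoint \<open>s / 2\<close> combined with a reflection of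
  \<open>\<real>\<^sup>4\<close>. In each of the planes spanned by \<open>a k\<close> and \<open>b k\<close> the reflection fixes
  \<open>E\<^sub>k = cos (\<phi> k * s) a\<^sub>k + sin (\<phi> k * s) b\<^sub>k\<close> and negates the perpendicular vector
  \<open>F\<^sub>k = cos (\<phi> k * s) b\<^sub>k - sin (\<phi> k * s) a\<^sub>k\<close>. Time reversal changes the sign of the area part of the
  trajectory. Hence \<open>\<gamma> s = (x, t)\<close> has \<open>x\<close> in the span of the \<open>E\<^sub>k\<close>, and \<open>t\<close> contains only the mixed
  terms \<open>E\<^sub>k \<and> F\<^sub>l\<close>. The explicit coefficients are in \<open>trajectory_control_eq\<close>; the proof there verifies
  the differential equation in the rotating frame.

  A pair of this shape lies in \<open>C\<^sub>4\<close> as soon as one scalar equation holds. Let \<open>e\<^sub>1, e\<^sub>2\<close> be orthonormal,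
  \<open>t = e\<^sub>1 \<and> w\<^sub>1 + e\<^sub>2 \<and> w\<^sub>2\<close> with \<open>w\<^sub>1, w\<^sub>2\<close> orthogonal to \<open>e\<^sub>1, e\<^sub>2\<close>. This form is invariant under
  rotating \<open>(e\<^sub>1, e\<^sub>2)\<close> and \<open>(w\<^sub>1, w\<^sub>2)\<close> by the same angle. If the rotation that takes \<open>e\<^sub>1\<close> to the
  direction of \<open>x\<close> makes the \<open>w\<close>'s orthogonal, then the rotated vectors exhibit \<open>(x, t)\<close> as an
  element of \<open>\<Sigma>\<^sub>1\<close> or \<open>\<Sigma>\<^sub>2\<close>, provided that \<open>w\<^sub>1, w\<^sub>2\<close> are independent
  (\<open>C4_nondegenerate\<close>). In matrix terms, the coordinate vector of \<open>x\<close> is an eigenvector of the Gram matrix of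
  \<open>w\<^sub>1, w\<^sub>2\<close>.

  It remains to find arbitrarily large zeros of the scalar \<open>imbalance\<close> that expresses this equation.

  Let \<open>q > 0\<close>. The imbalance is a polynomial of degree at most two in \<open>s\<close> whose coefficients are continuous
  functions of the two angles \<open>p s\<close> and \<open>q s\<close>. By Dirichlet's simultaneous approximation theorem there
  are translations \<open>T n\<close>, tending to infinity, under which all these coefficients converge to their
  original values; so the sign of the leading coefficient at any fixed time recurs as the sign of
  the imbalance at the translates (\<open>imbalance_changes_sign\<close>). The coefficient of \<open>s\<^sup>2\<close>
  is a constant multiple of \<open>sin (p s) sin (q s)\<close>, which takes both signs. The constant vanishes precisely when
  \<open>r\<^sub>1\<^sup>2 / p = r\<^sub>2\<^sup>2 / q\<close>, and then the coefficient of \<open>s\<close> takes over: it is an odd function that is nonzero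
  at \<open>pi / p\<close>. In both cases the intermediate value theorem gives the zeros. The independence
  condition holds for all large \<open>s\<close> because the diagonal coefficients of \<open>t\<close> grow linearly
  while the others stay bounded (\<open>area_determinant_eventually_pos\<close>).

  Let \<open>q = 0\<close>. Then \<open>t = (\<alpha> E\<^sub>1 + \<beta> E\<^sub>2) \<and> F\<^sub>1\<close> is decomposable, nonzero for large \<open>s\<close>, and \<open>\<gamma> s\<close> lies in \<open>\<Sigma>\<^sub>3\<close> once \<open>x\<close> is
  orthogonal to \<open>\<alpha> E\<^sub>1 + \<beta> E\<^sub>2\<close>. The inner product alternates in sign along the positive multiples of \<open>pi / p\<close>
  (\<open>zero_frequency_orthogonal_times\<close>).
\<close>

section \<open>The trajectory in the rotating frame\<close>

lemma wedge_nth: "(v \<and>\<^sub>w w) $ i $ j = v $ i * w $ j - v $ j * w $ i"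
  by (simp add: wedge_def)

lemma bounded_bilinear_wedge: "bounded_bilinear (\<and>\<^sub>w)"
  by (subst bilinear_conv_bounded_bilinear[symmetric])
    (auto simp: bilinear_def vec_eq_iff wedge_nth algebra_simps intro!: linearI)

lemmas wedge_has_vector_derivative =
  bounded_bilinear.has_vector_derivative[OF bounded_bilinear_wedge]

text \<open>The rotating frame turns at the frequency \<open>p\<close>, half that of the control, so that
  \<open>radial\<close> points along the axis of symmetry of the arc that the control describes up to time \<open>s\<close>.\<close>

definition radial :: "real \<Rightarrow> real^4 \<Rightarrow> real^4 \<Rightarrow> real \<Rightarrow> real^4" where
  "radial p a b s = cos (p * s) *\<^sub>R a + sin (p * s) *\<^sub>R b"

definition tangential :: "real \<Rightarrow> real^4 \<Rightarrow> real^4 \<Rightarrow> real \<Rightarrow> real^4" where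
  "tangential p a b s = cos (p * s) *\<^sub>R b - sin (p * s) *\<^sub>R a"

text \<open>The antiderivative of \<open>cos (p s)\<close> that vanishes at \<open>0\<close>. Including the limit case \<open>p = 0\<close> lets
  one formula for the trajectory cover the zero frequency as well.\<close>

definition chord :: "real \<Rightarrow> real \<Rightarrow> real" where
  "chord p s = (if p = 0 then s else sin (p * s) / p)"

text \<open>These are closed forms of \<open>(1/2) \<integral>\<^sub>0\<^sup>s chord p \<sigma> sin (p \<sigma>) d\<sigma>\<close> and \<open>\<integral>\<^sub>0\<^sup>s sin (p \<sigma>) chord q \<sigma> d\<sigma>\<close>,
  the second one for \<open>p\<^sup>2 \<noteq> q\<^sup>2\<close>. For \<open>p = 0\<close> the first integral is \<open>0\<close>, which is also the value that the division by zero
  assigns.\<close>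

definition diag_area :: "real \<Rightarrow> real \<Rightarrow> real" where
  "diag_area p s = (s - chord p s * cos (p * s)) / (4 * p)"

definition mixed_area :: "real \<Rightarrow> real \<Rightarrow> real \<Rightarrow> real" where
  "mixed_area p q s = (sin (p * s) * cos (q * s) - p * cos (p * s) * chord q s) / (p\<^sup>2 - q\<^sup>2)"

lemma radial_has_vector_derivative:
  "(radial p a b has_vector_derivative p *\<^sub>R tangential p a b s) (at s)"
  unfolding radial_def[abs_def] tangential_def
  by (auto intro!: derivative_eq_intros simp: algebra_simps)

lemma tangential_has_vector_derivative:
  "(tangential p a b has_vector_derivative - p *\<^sub>R radial p a b s) (at s)"
  unfolding radial_def tangential_def[abs_def]
  by (auto intro!: derivative_eq_intros simp: algebra_simps)

lemma sin_eq_chord: "sin (p * s) = p * chord p s"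
  by (simp add: chord_def)

lemma chord_has_derivative: "(chord p has_real_derivative cos (p * s)) (at s)"
  by (cases "p = 0") (auto simp: chord_def[abs_def] intro!: derivative_eq_intros)

lemma diag_area_has_derivative:
  "(diag_area p has_real_derivative chord p s * sin (p * s) / 2) (at s)"
proof (cases "p = 0")
  case True
  then show ?thesis by (simp add: diag_area_def[abs_def])
next
  case False
  have "(diag_area p has_real_derivative
      (1 - (cos (p * s) * cos (p * s) - chord p s * (sin (p * s) * p))) / (4 * p)) (at s)"
    unfolding diag_area_def[abs_def]
    by (intro DERIV_cdivide) (auto intro!: derivative_eq_intros chord_has_derivative)
  moreover have "1 - cos (p * s) * cos (p * s) = sin (p * s) * (p * chord p s)"
    using sin_cos_squared_add[of "p * s"] by (simp add: sin_eq_chord[symmetric] power2_eq_square)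
  then have "(1 - (cos (p * s) * cos (p * s) - chord p s * (sin (p * s) * p))) / (4 * p)
      = chord p s * sin (p * s) / 2"
    using False by (simp add: field_simps)
  ultimately show ?thesis by metis
qed

lemma mixed_area_has_derivative:
  assumes "p\<^sup>2 \<noteq> q\<^sup>2"
  shows "(mixed_area p q has_real_derivative sin (p * s) * chord q s) (at s)"
proof -
  have "(mixed_area p q has_real_derivative
      (p * cos (p * s) * cos (q * s) - sin (p * s) * (sin (q * s) * q)
        - (p * cos (p * s) * cos (q * s) - p * (sin (p * s) * p) * chord q s)) / (p\<^sup>2 - q\<^sup>2)) (at s)"
    unfolding mixed_area_def[abs_def]
    by (intro DERIV_cdivide) (auto intro!: derivative_eq_intros chord_has_derivative
        simp: algebra_simps)
  moreover have "p * cos (p * s) * cos (q * s) - sin (p * s) * (sin (q * s) * q)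
        - (p * cos (p * s) * cos (q * s) - p * (sin (p * s) * p) * chord q s)
      = sin (p * s) * chord q s * (p\<^sup>2 - q\<^sup>2)"
    by (simp add: sin_eq_chord[of q] algebra_simps power2_eq_square)
  ultimately show ?thesis using assms by simp
qed

lemma control_eq_moving_frame:
  "control a b \<phi> s = (\<Sum>k=1..2. cos (\<phi> k * s) *\<^sub>R radial (\<phi> k) (a k) (b k) s
      + sin (\<phi> k * s) *\<^sub>R tangential (\<phi> k) (a k) (b k) s)"
proof -
  have "cos (2 * \<phi> k * s) = cos (\<phi> k * s) * cos (\<phi> k * s) - sin (\<phi> k * s) * sin (\<phi> k * s)"
    "sin (2 * \<phi> k * s) = 2 * (sin (\<phi> k * s) * cos (\<phi> k * s))" for k
    using cos_double[of "\<phi> k * s"] sin_double[of "\<phi> k * s"]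
    by (simp_all add: mult.assoc power2_eq_square)
  then show ?thesis
    unfolding control_def radial_def tangential_def
    by (intro sum.cong) (simp_all only: vec_eq_iff vector_add_component vector_minus_component
        vector_scaleR_component real_scaleR_def, simp_all add: algebra_simps)
qed

text \<open>On the left is the derivative of the area part of the trajectory, differentiated term by term
  with the frame equations \<open>E' = p F\<close>, \<open>F' = - p E\<close>. The weights \<open>q K\<close> and \<open>p K\<close> of the two mixed
  terms are chosen so that \<open>F\<^sub>1 \<and> F\<^sub>2\<close> cancels; the assumption matches the coefficients of
  \<open>E\<^sub>1 \<and> E\<^sub>2\<close>.\<close>

lemma moving_frame_identity:
  assumes "2 * (K * (p\<^sup>2 - q\<^sup>2)) = x * c' - c * y"
  shows "E1 \<and>\<^sub>w (d *\<^sub>R (- p *\<^sub>R E1) + (x * (p * x) / 2) *\<^sub>R F1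
           + ((q * K) *\<^sub>R (- q *\<^sub>R E2) + (x * (q * y) / 2) *\<^sub>R F2))
        + (p *\<^sub>R F1) \<and>\<^sub>w (d *\<^sub>R F1 + (q * K) *\<^sub>R F2)
        + (E2 \<and>\<^sub>w ((p * K) *\<^sub>R (- p *\<^sub>R E1) + (p * x * y / 2) *\<^sub>R F1
           + (d' *\<^sub>R (- q *\<^sub>R E2) + (y * (q * y) / 2) *\<^sub>R F2))
        + (q *\<^sub>R F2) \<and>\<^sub>w ((p * K) *\<^sub>R F1 + d' *\<^sub>R F2))
      = (1/2) *\<^sub>R ((x *\<^sub>R E1 + y *\<^sub>R E2)
          \<and>\<^sub>w (c *\<^sub>R E1 + (p * x) *\<^sub>R F1 + (c' *\<^sub>R E2 + (q * y) *\<^sub>R F2)))"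
  (is "?L = ?R")
proof -
  have "2 * (?L $ i $ j - ?R $ i $ j)
      = (2 * (K * (p\<^sup>2 - q\<^sup>2)) - (x * c' - c * y)) * (E1 $ i * E2 $ j - E1 $ j * E2 $ i)" for i j
    by (simp add: wedge_nth field_simps power2_eq_square)
  then have "2 * (?L $ i $ j - ?R $ i $ j) = 0" for i j
    by (simp only: assms diff_self mult_zero_left)
  then show ?thesis
    unfolding vec_eq_iff by (metis eq_iff_diff_eq_0 mult_eq_0_iff zero_neq_numeral)
qed

text \<open>Trajectories are unique, so it suffices that the right-hand side solves the differential
  equation and vanishes at \<open>0\<close>. Differentiating in the rotating frame reduces the equation to
  \<open>moving_frame_identity\<close>.\<close>

lemma trajectory_control_eq:
  fixes a b :: "nat \<Rightarrow> real^4" and \<phi> :: "nat \<Rightarrow> real"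
  defines "p \<equiv> \<phi> 1" and "q \<equiv> \<phi> 2"
  defines "E1 \<equiv> radial p (a 1) (b 1)" and "F1 \<equiv> tangential p (a 1) (b 1)"
    and "E2 \<equiv> radial q (a 2) (b 2)" and "F2 \<equiv> tangential q (a 2) (b 2)"
  assumes pq: "p > q" "q \<ge> 0" and tr: "trajectory (control a b \<phi>) \<gamma>"
  shows "\<gamma> s = (chord p s *\<^sub>R E1 s + chord q s *\<^sub>R E2 s,
      E1 s \<and>\<^sub>w (diag_area p s *\<^sub>R F1 s + (q * mixed_area p q s / (2 * p)) *\<^sub>R F2 s)
    + E2 s \<and>\<^sub>w ((mixed_area p q s / 2) *\<^sub>R F1 s + diag_area q s *\<^sub>R F2 s))"
proof -
  let ?x = "\<lambda>s. chord p s *\<^sub>R E1 s + chord q s *\<^sub>R E2 s"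
  let ?w1 = "\<lambda>s. diag_area p s *\<^sub>R F1 s + (q * mixed_area p q s / (2 * p)) *\<^sub>R F2 s"
  let ?w2 = "\<lambda>s. (mixed_area p q s / 2) *\<^sub>R F1 s + diag_area q s *\<^sub>R F2 s"
  let ?t = "\<lambda>s. E1 s \<and>\<^sub>w ?w1 s + E2 s \<and>\<^sub>w ?w2 s"
  have p0: "p > 0" using pq by simp
  have pq2: "p\<^sup>2 \<noteq> q\<^sup>2" using pq by (metis less_le power2_eq_iff_nonneg less_eq_real_def order_trans)
  note frame = radial_has_vector_derivative[of p "a 1" "b 1", folded E1_def F1_def]
    radial_has_vector_derivative[of q "a 2" "b 2", folded E2_def F2_def]
    tangential_has_vector_derivative[of p "a 1" "b 1", folded E1_def F1_def]
    tangential_has_vector_derivative[of q "a 2" "b 2", folded E2_def F2_def]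
  have u: "control a b \<phi> s = cos (p * s) *\<^sub>R E1 s + sin (p * s) *\<^sub>R F1 s
      + (cos (q * s) *\<^sub>R E2 s + sin (q * s) *\<^sub>R F2 s)" for s
    unfolding control_eq_moving_frame E1_def E2_def F1_def F2_def p_def q_def
    by (simp add: numeral_2_eq_2)
  have dx: "(?x has_vector_derivative control a b \<phi> s) (at s)" for s
    unfolding u
    by (auto intro!: derivative_eq_intros frame chord_has_derivative
        simp: sin_eq_chord algebra_simps)
  have dt: "(?t has_vector_derivative (1/2) *\<^sub>R (?x s \<and>\<^sub>w control a b \<phi> s)) (at s)" for s
  proof -
    define J where "J = mixed_area p q s"
    let ?d = "E1 s \<and>\<^sub>w (diag_area p s *\<^sub>R (- p *\<^sub>R E1 s) + (chord p s * sin (p * s) / 2) *\<^sub>R F1 s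
           + ((q * J / (2 * p)) *\<^sub>R (- q *\<^sub>R E2 s) + (q * (sin (p * s) * chord q s) / (2 * p)) *\<^sub>R F2 s))
        + (p *\<^sub>R F1 s) \<and>\<^sub>w ?w1 s
        + (E2 s \<and>\<^sub>w ((J / 2) *\<^sub>R (- p *\<^sub>R E1 s) + (sin (p * s) * chord q s / 2) *\<^sub>R F1 s
           + (diag_area q s *\<^sub>R (- q *\<^sub>R E2 s) + (chord q s * sin (q * s) / 2) *\<^sub>R F2 s))
        + (q *\<^sub>R F2 s) \<and>\<^sub>w ?w2 s)"
    have "((\<lambda>s. q * mixed_area p q s / (2 * p)) has_real_derivative
        q * (sin (p * s) * chord q s) / (2 * p)) (at s)"
      by (intro DERIV_cdivide DERIV_cmult mixed_area_has_derivative pq2)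
    moreover have "((\<lambda>s. mixed_area p q s / 2) has_real_derivative sin (p * s) * chord q s / 2) (at s)"
      by (intro DERIV_cdivide mixed_area_has_derivative pq2)
    ultimately have "(?t has_vector_derivative ?d) (at s)"
      unfolding J_def
      by (intro has_vector_derivative_add wedge_has_vector_derivative frame
          has_vector_derivative_scaleR diag_area_has_derivative)
    moreover have "?d = (1/2) *\<^sub>R (?x s \<and>\<^sub>w control a b \<phi> s)"
    proof -
      \<comment> \<open>Both mixed coefficients are multiples of \<open>K\<close>, in the ratio \<open>q : p\<close>.\<close>
      define K where "K = J / (2 * p)"
      have K: "q * J / (2 * p) = q * K" "J / 2 = p * K"
        "mixed_area p q s / 2 = p * K" "q * mixed_area p q s / (2 * p) = q * K"
        using p0 by (simp_all add: K_def J_def)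
      have "J * (p\<^sup>2 - q\<^sup>2) = sin (p * s) * cos (q * s) - p * cos (p * s) * chord q s"
        using pq2 by (simp add: J_def mixed_area_def)
      moreover have "J = 2 * p * K" using p0 by (simp add: K_def)
      ultimately have "p * (2 * (K * (p\<^sup>2 - q\<^sup>2))) = p * (chord p s * cos (q * s) - cos (p * s) * chord q s)"
        using sin_eq_chord[of p s] by algebra
      then have K2: "2 * (K * (p\<^sup>2 - q\<^sup>2)) = chord p s * cos (q * s) - cos (p * s) * chord q s"
        by (rule mult_left_cancel[THEN iffD1, rotated]) (use p0 in simp)
      have m: "q * (sin (p * s) * chord q s) / (2 * p) = chord p s * sin (q * s) / 2"
        using p0 by (simp add: sin_eq_chord)
      show ?thesis
        unfolding u K m unfolding sin_eq_chord using K2 by (rule moving_frame_identity)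
    qed
    ultimately show ?thesis by simp
  qed
  have "trajectory (control a b \<phi>) (\<lambda>s. (?x s, ?t s))"
    unfolding trajectory_def using dx dt
    by (auto intro!: has_vector_derivative_Pair simp: chord_def diag_area_def mixed_area_def wedge_nth vec_eq_iff)
  then have "\<gamma> = (\<lambda>s. (?x s, ?t s))"
    using trajectory_exists_unique[OF continuous_on_control] tr by blast
  then show ?thesis by simp
qed

section \<open>Membership in the target set\<close>

lemma ex_orthonormal_family:
  fixes v1 v2 v3 v4 :: "real^4"
  assumes "v1 \<bullet> v1 = 1" "v2 \<bullet> v2 = 1" "v3 \<bullet> v3 = 1" "v4 \<bullet> v4 = 1"
    and "v1 \<bullet> v2 = 0" "v1 \<bullet> v3 = 0" "v1 \<bullet> v4 = 0" "v2 \<bullet> v3 = 0" "v2 \<bullet> v4 = 0" "v3 \<bullet> v4 = 0"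
  obtains u where "orthonormal_family u" "u 1 = v1" "u 2 = v2" "u 3 = v3" "u 4 = v4"
proof
  let ?u = "\<lambda>i::nat. if i = 1 then v1 else if i = 2 then v2 else if i = 3 then v3 else v4"
  have "{1..4} = {1, 2, 3, 4::nat}" by auto
  then show "orthonormal_family ?u"
    using assms by (auto simp: orthonormal_family_def inner_commute)
qed simp_all

lemma wedge_rotate:
  assumes "c\<^sup>2 + d\<^sup>2 = 1"
  shows "(c *\<^sub>R e1 + d *\<^sub>R e2) \<and>\<^sub>w (c *\<^sub>R w1 + d *\<^sub>R w2)
    + (c *\<^sub>R e2 - d *\<^sub>R e1) \<and>\<^sub>w (c *\<^sub>R w2 - d *\<^sub>R w1) = e1 \<and>\<^sub>w w1 + e2 \<and>\<^sub>w w2" (is "?L = ?R")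
proof -
  have "?L $ i $ j = (c\<^sup>2 + d\<^sup>2) * ?R $ i $ j" for i j
    by (simp add: wedge_nth algebra_simps power2_eq_square)
  then show ?thesis by (simp add: assms vec_eq_iff)
qed

lemma wedge_scaleR_right: "v \<and>\<^sub>w (c *\<^sub>R w) = c *\<^sub>R (v \<and>\<^sub>w w)"
  by (simp add: vec_eq_iff wedge_nth algebra_simps)

lemma wedge_scaleR_left: "(c *\<^sub>R v) \<and>\<^sub>w w = c *\<^sub>R (v \<and>\<^sub>w w)"
  by (simp add: vec_eq_iff wedge_nth algebra_simps)

text \<open>The condition \<open>balance\<close> says that, unless \<open>\<alpha> e\<^sub>1 + \<beta> e\<^sub>2\<close> is zero, the rotation taking \<open>e\<^sub>1\<close> to
  its direction turns \<open>w\<^sub>1, w\<^sub>2\<close> into orthogonal vectors; their normalisations complete the rotated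
  \<open>e\<close>'s to the required orthonormal family, and their lengths are the two coefficients, which decide
  between \<open>\<Sigma>\<^sub>1\<close> and \<open>\<Sigma>\<^sub>2\<close>.\<close>

lemma C4_nondegenerate:
  fixes e1 e2 w1 w2 :: "real^4"
  assumes e: "e1 \<bullet> e1 = 1" "e2 \<bullet> e2 = 1" "e1 \<bullet> e2 = 0"
    and ew: "e1 \<bullet> w1 = 0" "e1 \<bullet> w2 = 0" "e2 \<bullet> w1 = 0" "e2 \<bullet> w2 = 0"
    and indep: "\<And>x y. x *\<^sub>R w1 + y *\<^sub>R w2 = 0 \<Longrightarrow> x = 0 \<and> y = 0"
    and balance: "\<alpha> * \<beta> * (w2 \<bullet> w2 - w1 \<bullet> w1) + (w1 \<bullet> w2) * (\<alpha>\<^sup>2 - \<beta>\<^sup>2) = 0"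
  shows "(\<alpha> *\<^sub>R e1 + \<beta> *\<^sub>R e2, e1 \<and>\<^sub>w w1 + e2 \<and>\<^sub>w w2) \<in> C\<^sub>4"
proof -
  define D where "D = w2 \<bullet> w2 - w1 \<bullet> w1"
  define G where "G = w1 \<bullet> w2"
  obtain \<rho> c d where cd: "c\<^sup>2 + d\<^sup>2 = 1" "c * d * D + G * (c\<^sup>2 - d\<^sup>2) = 0"
    and \<rho>: "\<alpha> = \<rho> * c" "\<beta> = \<rho> * d"
  proof -
    obtain \<rho> \<theta> where \<theta>: "\<alpha> = \<rho> * cos \<theta>" "\<beta> = \<rho> * sin \<theta>" using polar_Ex by blast
    obtain r \<omega> where \<omega>: "D = r * cos \<omega>" "- 2 * G = r * sin \<omega>" using polar_Ex by blast
    show thesis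
    proof (cases "\<rho> = 0")
      \<comment> \<open>If the displacement is zero, any rotation that orthogonalises \<open>w\<^sub>1, w\<^sub>2\<close> will do. One exists, as
        the condition is a linear equation for the cosine and sine of the doubled angle.\<close>
      case True
      have half: "(cos (\<omega>/2))\<^sup>2 - (sin (\<omega>/2))\<^sup>2 = cos \<omega>"
        "2 * (cos (\<omega>/2) * sin (\<omega>/2)) = sin \<omega>"
        using cos_double[of "\<omega>/2"] sin_double[of "\<omega>/2"] by simp_all
      have "2 * (cos (\<omega>/2) * sin (\<omega>/2) * D + G * ((cos (\<omega>/2))\<^sup>2 - (sin (\<omega>/2))\<^sup>2))
          = sin \<omega> * D + (2 * G) * cos \<omega>"
        unfolding half(1) half(2)[symmetric] by (simp add: algebra_simps)
      also have "2 * G = - (r * sin \<omega>)" using \<omega>(2) by simp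
      finally show thesis using True \<theta> \<omega>(1)
        by (intro that[of "cos (\<omega>/2)" "sin (\<omega>/2)" 0]) simp_all
    next
      case False
      have "\<rho>\<^sup>2 * (cos \<theta> * sin \<theta> * D + G * ((cos \<theta>)\<^sup>2 - (sin \<theta>)\<^sup>2)) = 0"
        using balance unfolding \<theta> D_def[symmetric] G_def[symmetric]
        by (simp add: algebra_simps power2_eq_square)
      then show thesis using False \<theta> by (intro that[of "cos \<theta>" "sin \<theta>" \<rho>]) simp_all
    qed
  qed
  define v where "v = c *\<^sub>R w1 + d *\<^sub>R w2"
  define v' where "v' = c *\<^sub>R w2 - d *\<^sub>R w1"
  define p where "p = c *\<^sub>R e1 + d *\<^sub>R e2"
  define q where "q = c *\<^sub>R e2 - d *\<^sub>R e1"
  note inn = inner_add_left inner_add_right inner_diff_left inner_diff_right inner_scaleR_left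
    inner_scaleR_right
  have "v \<noteq> 0" using indep[of c d] cd(1) by (auto simp: v_def)
  moreover have "v' \<noteq> 0" using indep[of "-d" c] cd(1) by (auto simp: v'_def)
  ultimately have n: "norm v > 0" "norm v' > 0" by simp_all
  have pq: "p \<bullet> p = 1" "q \<bullet> q = 1" "p \<bullet> q = 0" "p \<bullet> v = 0" "p \<bullet> v' = 0" "v \<bullet> q = 0" "q \<bullet> v' = 0"
    using cd(1) e ew by (simp_all add: p_def q_def v_def v'_def inn inner_commute power2_eq_square)
  have vv: "v \<bullet> v' = 0"
    using cd(2) by (simp add: v_def v'_def inn D_def G_def inner_commute power2_eq_square algebra_simps)
  have unit: "(1 / norm w) * ((1 / norm w) * (w \<bullet> w)) = 1" if "norm w > 0" for w :: "real^4"
    using that by (simp add: dot_square_norm power2_eq_square)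
  obtain u where u: "orthonormal_family u" "u 1 = p" "u 2 = (1 / norm v) *\<^sub>R v" "u 3 = q"
    "u 4 = (1 / norm v') *\<^sub>R v'"
    using pq vv unit[OF n(1)] unit[OF n(2)]
    by - (rule ex_orthonormal_family[of p "(1 / norm v) *\<^sub>R v" q "(1 / norm v') *\<^sub>R v'"],
        simp_all add: inn)
  have x: "\<alpha> *\<^sub>R e1 + \<beta> *\<^sub>R e2 = \<rho> *\<^sub>R u 1 + 0 *\<^sub>R u 2"
    unfolding u p_def by (simp add: \<rho> scaleR_add_right)
  have t: "e1 \<and>\<^sub>w w1 + e2 \<and>\<^sub>w w2 = norm v *\<^sub>R (u 1 \<and>\<^sub>w u 2) + norm v' *\<^sub>R (u 3 \<and>\<^sub>w u 4)"
    unfolding u using n wedge_rotate[OF cd(1), of e1 e2 w1 w2]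
    by (simp add: wedge_scaleR_right p_def[symmetric] q_def[symmetric] v_def[symmetric]
        v'_def[symmetric])
  show ?thesis
  proof (cases "norm v = norm v'")
    case True
    have "e1 \<and>\<^sub>w w1 + e2 \<and>\<^sub>w w2 = norm v *\<^sub>R (u 1 \<and>\<^sub>w u 2 + u 3 \<and>\<^sub>w u 4)"
      unfolding t True by (simp add: scaleR_add_right)
    then have "(\<alpha> *\<^sub>R e1 + \<beta> *\<^sub>R e2, e1 \<and>\<^sub>w w1 + e2 \<and>\<^sub>w w2) \<in> \<Sigma>\<^sub>2"
      unfolding \<Sigma>\<^sub>2_def using u(1) n(1) by blast
    then show ?thesis by (simp add: C\<^sub>4_def)
  next
    case False
    then have "(\<alpha> *\<^sub>R e1 + \<beta> *\<^sub>R e2, e1 \<and>\<^sub>w w1 + e2 \<and>\<^sub>w w2) \<in> \<Sigma>\<^sub>1"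
      unfolding \<Sigma>\<^sub>1_def x t using u(1) n by blast
    then show ?thesis by (simp add: C\<^sub>4_def)
  qed
qed

text \<open>For a decomposable second component, \<open>\<Sigma>\<^sub>3\<close> asks the first one to be orthogonal to its plane.\<close>

lemma C4_degenerate:
  fixes e1 e2 f1 f2 :: "real^4"
  assumes "e1 \<bullet> e1 = 1" "e2 \<bullet> e2 = 1" "f1 \<bullet> f1 = 1" "f2 \<bullet> f2 = 1"
    and "e1 \<bullet> e2 = 0" "e1 \<bullet> f1 = 0" "e1 \<bullet> f2 = 0" "e2 \<bullet> f1 = 0" "e2 \<bullet> f2 = 0" "f1 \<bullet> f2 = 0"
    and \<alpha>: "\<alpha> \<noteq> 0" and orth: "\<xi> * \<alpha> + \<eta> * \<beta> = 0"
  shows "(\<xi> *\<^sub>R e1 + \<eta> *\<^sub>R e2, (\<alpha> *\<^sub>R e1 + \<beta> *\<^sub>R e2) \<and>\<^sub>w f1) \<in> C\<^sub>4"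
proof -
  define l where "l = sqrt (\<alpha>\<^sup>2 + \<beta>\<^sup>2)"
  have l: "l > 0" using \<alpha> by (simp add: l_def sum_power2_gt_zero_iff)
  have l2: "\<alpha> * \<alpha> + \<beta> * \<beta> = l * l" by (simp add: l_def power2_eq_square)
  define p where "p = (1 / l) *\<^sub>R (\<alpha> *\<^sub>R e2 - \<beta> *\<^sub>R e1)"
  define q where "q = (1 / l) *\<^sub>R (\<alpha> *\<^sub>R e1 + \<beta> *\<^sub>R e2)"
  note inn = inner_add_left inner_add_right inner_diff_left inner_diff_right inner_scaleR_left
    inner_scaleR_right
  have "p \<bullet> p = 1" "q \<bullet> q = 1" "p \<bullet> q = 0" "p \<bullet> f1 = 0" "p \<bullet> f2 = 0" "q \<bullet> f1 = 0" "f2 \<bullet> q = 0"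
    using assms l l2 by (simp_all add: p_def q_def inn inner_commute field_simps)
  then obtain u where u: "orthonormal_family u" "u 1 = p" "u 2 = f2" "u 3 = q" "u 4 = f1"
    using assms by - (rule ex_orthonormal_family[of p f2 q f1], simp_all add: inner_commute)
  define k where "k = \<eta> * \<alpha> - \<xi> * \<beta>"
  have "\<xi> * (l * l) = - (k * \<beta>)" "\<eta> * (l * l) = k * \<alpha>"
    using orth unfolding l2[symmetric] k_def by algebra+
  then have \<xi>: "\<xi> = - (k / l * (\<beta> / l))" and \<eta>: "\<eta> = k / l * (\<alpha> / l)"
    using l by (simp_all add: field_simps)
  have "\<xi> *\<^sub>R e1 + \<eta> *\<^sub>R e2 = (k / l) *\<^sub>R u 1"
    unfolding u p_def \<xi> \<eta> by (simp add: scaleR_diff_right)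
  moreover have "(\<alpha> *\<^sub>R e1 + \<beta> *\<^sub>R e2) \<and>\<^sub>w f1 = l *\<^sub>R (u 3 \<and>\<^sub>w u 4)"
    using l by (simp add: u q_def wedge_scaleR_left)
  ultimately have "(\<xi> *\<^sub>R e1 + \<eta> *\<^sub>R e2, (\<alpha> *\<^sub>R e1 + \<beta> *\<^sub>R e2) \<and>\<^sub>w f1) \<in> \<Sigma>\<^sub>3"
    unfolding \<Sigma>\<^sub>3_def using u(1) l by blast
  then show ?thesis by (simp add: C\<^sub>4_def)
qed

section \<open>Recurrence and sign changes\<close>

text \<open>Dirichlet's theorem alone may return a bounded sequence of denominators, for instance when \<open>p\<close>
  and \<open>q\<close> are rational multiples of \<open>pi\<close>. Applying it with accuracy \<open>1 / N\<close> to \<open>N p / (2 pi)\<close> and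
  \<open>N q / (2 pi)\<close> instead makes the resulting period a positive multiple of \<open>N\<close>, hence large.\<close>

lemma common_almost_period:
  fixes p q :: real
  obtains T :: "nat \<Rightarrow> real" where "filterlim T at_top sequentially"
    "\<And>r s. r = p \<or> r = q \<Longrightarrow> (\<lambda>n. sin (r * (s + T n))) \<longlonglongrightarrow> sin (r * s)"
    "\<And>r s. r = p \<or> r = q \<Longrightarrow> (\<lambda>n. cos (r * (s + T n))) \<longlonglongrightarrow> cos (r * s)"
proof -
  have "\<exists>t. real (Suc n) \<le> t \<and> (\<forall>r\<in>{p, q}. \<exists>m::int. \<bar>r * t - 2 * pi * m\<bar> \<le> 2 * pi / Suc n)" for n
  proof -
    define N where "N = real (Suc n)"
    define \<theta> where "\<theta> i = (if i = 0 then p else q) * N / (2 * pi)" for i :: nat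
    obtain k m where k: "0 < k" and m: "\<And>i. i < 2 \<Longrightarrow> \<bar>of_int k * \<theta> i - of_int (m i)\<bar> < 1 / real (Suc n)"
      using Dirichlet_approx_simult[of "Suc n" 2 \<theta>] by (metis zero_less_Suc)
    have close: "\<bar>r * (k * N) - 2 * pi * m i\<bar> \<le> 2 * pi / Suc n"
      if "i < 2" "r = (if i = 0 then p else q)" for i r
    proof -
      have "r * (k * N) - 2 * pi * m i = 2 * pi * (of_int k * \<theta> i - of_int (m i))"
        using that by (simp add: \<theta>_def field_simps)
      then have "\<bar>r * (k * N) - 2 * pi * m i\<bar> = 2 * pi * \<bar>of_int k * \<theta> i - of_int (m i)\<bar>"
        by (simp add: abs_mult)
      also have "\<dots> \<le> 2 * pi * (1 / Suc n)"
        using m[OF that(1)] by (intro mult_left_mono) auto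
      finally show ?thesis by simp
    qed
    have "1 * N \<le> real_of_int k * N" using k by (intro mult_right_mono) (auto simp: N_def)
    then show ?thesis
      using close[of 0 p] close[of 1 q] by (intro exI[of _ "k * N"]) (auto simp: N_def)
  qed
  then obtain T where T: "\<And>n. real (Suc n) \<le> T n"
    "\<And>n r. r = p \<or> r = q \<Longrightarrow> \<exists>m::int. \<bar>r * T n - 2 * pi * m\<bar> \<le> 2 * pi / Suc n"
    by (metis insertI1 insertI2)
  have lim: "filterlim T at_top sequentially"
    by (rule filterlim_at_top_mono[OF filterlim_real_sequentially])
      (use T(1) in \<open>auto intro!: always_eventually order_trans[OF _ T(1)]\<close>)
  have near: "(\<lambda>n. sin (r * T n)) \<longlonglongrightarrow> 0 \<and> (\<lambda>n. cos (r * T n)) \<longlonglongrightarrow> 1" if r: "r = p \<or> r = q" for r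
  proof -
    obtain m :: "nat \<Rightarrow> int" where m: "\<And>n. \<bar>r * T n - 2 * pi * m n\<bar> \<le> 2 * pi / Suc n"
      using T(2)[OF r] by metis
    define \<delta> where "\<delta> n = r * T n - 2 * pi * m n" for n
    have "(\<lambda>n. 2 * pi / Suc n) \<longlonglongrightarrow> 0"
      using LIMSEQ_Suc[OF lim_const_over_n[of "2 * pi"]] by simp
    then have \<delta>: "\<delta> \<longlonglongrightarrow> 0"
      using m by (intro Lim_null_comparison[of \<delta>]) (auto simp: \<delta>_def)
    have "sin (r * T n) = sin (\<delta> n)" "cos (r * T n) = cos (\<delta> n)" for n
      using sin_int_2pin[of "m n"] cos_int_2pin[of "m n"]
      by (simp_all add: \<delta>_def sin_diff cos_diff)
    then show ?thesis using tendsto_sin[OF \<delta>] tendsto_cos[OF \<delta>] by simp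
  qed
  show thesis
  proof (rule that[OF lim])
    fix r s assume r: "r = p \<or> r = q"
    have "(\<lambda>n. sin (r * s) * cos (r * T n) + cos (r * s) * sin (r * T n)) \<longlonglongrightarrow> sin (r * s) * 1 + cos (r * s) * 0"
      using near[OF r] by (intro tendsto_intros) auto
    then show "(\<lambda>n. sin (r * (s + T n))) \<longlonglongrightarrow> sin (r * s)"
      by (simp add: distrib_left sin_add)
    have "(\<lambda>n. cos (r * s) * cos (r * T n) - sin (r * s) * sin (r * T n)) \<longlonglongrightarrow> cos (r * s) * 1 - sin (r * s) * 0"
      using near[OF r] by (intro tendsto_intros) auto
    then show "(\<lambda>n. cos (r * (s + T n))) \<longlonglongrightarrow> cos (r * s)"
      by (simp add: distrib_left cos_add)
  qed
qed

lemma zero_beyond_if_changes_sign: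
  fixes h :: "real \<Rightarrow> real"
  assumes h: "continuous_on UNIV h" and T: "filterlim T at_top sequentially"
    and pos: "eventually (\<lambda>n. h (s + T n) > 0) sequentially"
    and neg: "eventually (\<lambda>n. h (s' + T n) < 0) sequentially"
  shows "\<exists>t\<ge>N. h t = 0"
proof -
  have "eventually (\<lambda>n. T n \<ge> N - s \<and> T n \<ge> N - s') sequentially"
    using T by (auto simp: filterlim_at_top eventually_conj_iff)
  then have "eventually (\<lambda>n. h (s + T n) > 0 \<and> h (s' + T n) < 0 \<and> s + T n \<ge> N \<and> s' + T n \<ge> N) sequentially"
    using pos neg by eventually_elim auto
  then obtain n where n: "h (s + T n) > 0" "h (s' + T n) < 0" "s + T n \<ge> N" "s' + T n \<ge> N"
    by (auto dest: eventually_happens)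
  have c: "continuous_on S h" for S using h continuous_on_subset by blast
  show ?thesis
  proof (cases "s + T n \<le> s' + T n")
    case True
    then show ?thesis
      using IVT2'[OF less_imp_le[OF n(2)] less_imp_le[OF n(1)] True c] n(3) by (meson order_trans)
  next
    case False
    then show ?thesis
      using IVT'[OF less_imp_le[OF n(2)] less_imp_le[OF n(1)] _ c] n(4)
      by (meson order_trans linear)
  qed
qed

section \<open>Zeros of the imbalance for positive frequencies\<close>

text \<open>This is the expression in \<open>C4_nondegenerate\<close>, up to a positive factor, for the first component
  \<open>x E\<^sub>1 + y E\<^sub>2\<close> and the second component \<open>E\<^sub>1 \<and> (a F\<^sub>1 + k F\<^sub>2) + E\<^sub>2 \<and> (j F\<^sub>1 + b F\<^sub>2)\<close>, when the
  orthogonal vectors \<open>E\<^sub>1, F\<^sub>1\<close> have squared length \<open>R\<close> and \<open>E\<^sub>2, F\<^sub>2\<close> have squared length \<open>R'\<close>; see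
  \<open>C4_if_imbalance_zero\<close>.\<close>

definition imbalance_form ::
    "real \<Rightarrow> real \<Rightarrow> real \<Rightarrow> real \<Rightarrow> real \<Rightarrow> real \<Rightarrow> real \<Rightarrow> real \<Rightarrow> real" where
  "imbalance_form R R' x y a k j b =
     x * y * (R' * (R * j\<^sup>2 + R' * b\<^sup>2) - R * (R * a\<^sup>2 + R' * k\<^sup>2))
     + (R * a * j + R' * k * b) * (R * x\<^sup>2 - R' * y\<^sup>2)"

lemma imbalance_form_scale:
  "imbalance_form R R' x y (a * c) (k * c) (j * c) (b * c) = imbalance_form R R' x y a k j b * c\<^sup>2"
  unfolding imbalance_form_def by algebra

definition imbalance :: "real \<Rightarrow> real \<Rightarrow> real \<Rightarrow> real \<Rightarrow> real \<Rightarrow> real" where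
  "imbalance R R' p q s = imbalance_form R R' (chord p s) (chord q s)
     (diag_area p s) (q * mixed_area p q s / (2 * p)) (mixed_area p q s / 2) (diag_area q s)"

lemma continuous_on_chord: "continuous_on S (chord p)"
  using chord_has_derivative by (meson DERIV_isCont continuous_at_imp_continuous_on)

lemma continuous_on_diag_area: "continuous_on S (diag_area p)"
  using diag_area_has_derivative by (meson DERIV_isCont continuous_at_imp_continuous_on)

lemma continuous_on_mixed_area: "continuous_on S (mixed_area p q)"
  unfolding mixed_area_def[abs_def] divide_inverse by (intro continuous_intros continuous_on_chord)

lemma continuous_on_imbalance: "continuous_on S (imbalance R R' p q)"
  unfolding imbalance_def[abs_def] imbalance_form_def divide_inverse
  by (intro continuous_intros continuous_on_chord continuous_on_diag_area continuous_on_mixed_area)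

text \<open>The limits of \<open>imbalance / T n ^ 2\<close> along \<open>s + T n\<close> are a nonzero multiple of
  \<open>sin (p s) sin (q s)\<close> unless \<open>R / p = R' / q\<close>. In that resonant case the quadratic terms cancel and
  \<open>imbalance / T n\<close> converges to an odd function of \<open>s\<close>.\<close>

lemma imbalance_changes_sign:
  assumes pq: "p > q" "q > 0" and R: "R > 0" "R' > 0"
  obtains T s s' where "filterlim T at_top sequentially"
    "eventually (\<lambda>n. imbalance R R' p q (s + T n) > 0) sequentially"
    "eventually (\<lambda>n. imbalance R R' p q (s' + T n) < 0) sequentially"
proof -
  let ?h = "imbalance R R' p q"
  obtain T where T: "filterlim T at_top sequentially"
    and sin_lim: "\<And>r s. r = p \<or> r = q \<Longrightarrow> (\<lambda>n. sin (r * (s + T n))) \<longlonglongrightarrow> sin (r * s)"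
    and cos_lim: "\<And>r s. r = p \<or> r = q \<Longrightarrow> (\<lambda>n. cos (r * (s + T n))) \<longlonglongrightarrow> cos (r * s)"
    using common_almost_period by blast
  have p: "p > 0" using pq by simp
  have pq2: "p\<^sup>2 - q\<^sup>2 > 0" using pq by (simp add: power_strict_mono)
  have T0: "eventually (\<lambda>n. T n > 0) sequentially"
    using T by (simp add: filterlim_at_top_dense)
  have chord_lim: "(\<lambda>n. chord r (s + T n)) \<longlonglongrightarrow> chord r s" if "r = p \<or> r = q" for r s
  proof -
    have "r \<noteq> 0" using that pq by auto
    then show ?thesis
      unfolding chord_def using that by (auto intro!: tendsto_intros sin_lim)
  qed
  have mixed_lim: "(\<lambda>n. mixed_area p q (s + T n)) \<longlonglongrightarrow> mixed_area p q s" for s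
    unfolding mixed_area_def using pq2 by (intro tendsto_intros sin_lim cos_lim chord_lim) auto
  have inv_lim: "(\<lambda>n. inverse (T n)) \<longlonglongrightarrow> 0"
    by (rule tendsto_inverse_0_at_top[OF T])
  have diag_lim: "(\<lambda>n. diag_area r (s + T n) / T n) \<longlonglongrightarrow> 1 / (4 * r)" if "r = p \<or> r = q" for r s
  proof -
    have "(\<lambda>n. (1 + (s - chord r (s + T n) * cos (r * (s + T n))) * inverse (T n)) / (4 * r))
        \<longlonglongrightarrow> (1 + (s - chord r s * cos (r * s)) * 0) / (4 * r)"
      using that pq by (intro tendsto_intros chord_lim cos_lim inv_lim) auto
    then have lim: "(\<lambda>n. (1 + (s - chord r (s + T n) * cos (r * (s + T n))) * inverse (T n)) / (4 * r))
        \<longlonglongrightarrow> 1 / (4 * r)" by simp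
    show ?thesis
      by (rule Lim_transform_eventually[OF lim])
        (use T0 in eventually_elim, simp add: diag_area_def field_simps)
  qed
  have pos_if: "eventually (\<lambda>n. ?h (s + T n) > 0) sequentially"
    if "(\<lambda>n. ?h (s + T n) / T n ^ k) \<longlonglongrightarrow> L" "L > 0" for s L k
    using order_tendstoD(1)[OF that] T0 by eventually_elim (simp add: zero_less_divide_iff)
  have neg_if: "eventually (\<lambda>n. ?h (s + T n) < 0) sequentially"
    if "(\<lambda>n. ?h (s + T n) / T n ^ k) \<longlonglongrightarrow> L" "L < 0" for s L k
    using order_tendstoD(2)[OF that] T0 by eventually_elim (simp add: divide_less_0_iff)
  show thesis
  proof (cases "R / p = R' / q")
    case False
    \<comment> \<open>\<open>A\<close> is the coefficient of the square of the time: only the diagonal areas, which grow like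
      \<open>T n / (4 p)\<close> and \<open>T n / (4 q)\<close>, contribute to it.\<close>
    define A where "A s = chord p s * chord q s * ((R' / q)\<^sup>2 - (R / p)\<^sup>2) / 16" for s
    have lim: "(\<lambda>n. ?h (s + T n) / T n ^ 2) \<longlonglongrightarrow> A s" for s
    proof -
      let ?a = "\<lambda>n. diag_area p (s + T n) / T n" and ?b = "\<lambda>n. diag_area q (s + T n) / T n"
      let ?J = "\<lambda>n. mixed_area p q (s + T n)" and ?i = "\<lambda>n. inverse (T n)"
      let ?x = "\<lambda>n. chord p (s + T n)" and ?y = "\<lambda>n. chord q (s + T n)"
      have "?h (s + T n) / T n ^ 2 = imbalance_form R R' (?x n) (?y n)
          (?a n) (q * ?J n / (2 * p) * ?i n) (?J n / 2 * ?i n) (?b n)" for n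
        by (simp only: imbalance_def divide_inverse[of _ "T n"] divide_inverse[of _ "T n ^ 2"]
            power_inverse[symmetric] imbalance_form_scale)
      moreover have "(\<lambda>n. imbalance_form R R' (?x n) (?y n)
          (?a n) (q * ?J n / (2 * p) * ?i n) (?J n / 2 * ?i n) (?b n))
          \<longlonglongrightarrow> imbalance_form R R' (chord p s) (chord q s) (1 / (4 * p))
            (q * mixed_area p q s / (2 * p) * 0) (mixed_area p q s / 2 * 0) (1 / (4 * q))"
        unfolding imbalance_form_def
        using p by (intro tendsto_intros chord_lim mixed_lim diag_lim inv_lim) auto
      moreover have "imbalance_form R R' (chord p s) (chord q s) (1 / (4 * p))
          (q * mixed_area p q s / (2 * p) * 0) (mixed_area p q s / 2 * 0) (1 / (4 * q)) = A s"
        by (simp add: A_def imbalance_form_def power2_eq_square algebra_simps)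
      ultimately show ?thesis by simp
    qed
    \<comment> \<open>At \<open>s1\<close> both sines are positive. Just beyond \<open>pi / p\<close> the first is negative, while the second,
      of lower frequency, is still positive.\<close>
    define s1 where "s1 = pi / (2 * p)"
    have "pi / p < pi / q" using pq by (intro divide_strict_left_mono) auto
    then obtain s2 where "pi / p < s2" "s2 < min (pi / q) (2 * pi / p)"
      using p by (metis dense min_less_iff_conj divide_strict_right_mono pi_gt_zero mult_2 less_add_same_cancel1)
    moreover from this have "s2 > 0" using p by (auto intro: less_trans[of 0 "pi / p"])
    ultimately have s2: "p * s2 > pi" "p * s2 < 2 * pi" "q * s2 > 0" "q * s2 < pi"
      using p pq by (auto simp: field_simps)
    have "p * s1 = pi / 2" "q * s1 < pi" "q * s1 > 0"
      using p pq by (auto simp: s1_def field_simps intro: less_le_trans)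
    then have pos: "chord p s1 * chord q s1 > 0"
      using p pq by (simp add: chord_def sin_gt_zero)
    have neg: "chord p s2 * chord q s2 < 0"
      using p pq s2 by (simp add: chord_def sin_gt_zero sin_lt_zero divide_neg_pos mult_neg_pos)
    have D: "(R' / q)\<^sup>2 \<noteq> (R / p)\<^sup>2"
      using False R p pq by (simp add: power2_eq_iff_nonneg)
    show thesis
    proof (cases "(R' / q)\<^sup>2 > (R / p)\<^sup>2")
      case True
      then have "A s1 > 0" "A s2 < 0"
        using pos neg by (simp_all add: A_def mult_neg_pos)
      then show thesis using that[OF T pos_if[OF lim] neg_if[OF lim]] by blast
    next
      case F: False
      then have "A s2 > 0" "A s1 < 0"
        using pos neg D by (simp_all add: A_def mult_pos_neg mult_neg_neg)
      then show thesis using that[OF T pos_if[OF lim] neg_if[OF lim]] by blast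
    qed
  next
    case True
    define \<rho> where "\<rho> = R / p"
    have R_eq: "R = \<rho> * p" "R' = \<rho> * q" using True p pq by (auto simp: \<rho>_def field_simps)
    have \<rho>: "\<rho> > 0" using R p by (simp add: \<rho>_def)
    \<comment> \<open>\<open>B\<close> is the coefficient of the time itself. The difference \<open>R' b - R a\<close> of the weighted diagonal
      areas stays bounded here and equals \<open>?d n\<close> below, so its product with their sum grows at most linearly.\<close>
    define B where "B s = chord p s * chord q s * (\<rho> * (chord p s * cos (p * s) - chord q s * cos (q * s)) / 4) * (\<rho> / 2)
      + \<rho> * mixed_area p q s * (p + q) / (8 * p) * (R * (chord p s)\<^sup>2 - R' * (chord q s)\<^sup>2)" for s
    have lim: "(\<lambda>n. ?h (s + T n) / T n ^ 1) \<longlonglongrightarrow> B s" for s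
    proof -
      let ?a = "\<lambda>n. diag_area p (s + T n) / T n" and ?b = "\<lambda>n. diag_area q (s + T n) / T n"
      let ?J = "\<lambda>n. mixed_area p q (s + T n)" and ?i = "\<lambda>n. inverse (T n)"
      let ?x = "\<lambda>n. chord p (s + T n)" and ?y = "\<lambda>n. chord q (s + T n)"
      let ?d = "\<lambda>n. \<rho> * (?x n * cos (p * (s + T n)) - ?y n * cos (q * (s + T n))) / 4"
      let ?l = "\<lambda>x y a k j b i d. x * y * (R' * R * j\<^sup>2 * i - R * R' * k\<^sup>2 * i + d * (R' * b + R * a))
        + (R * a * j + R' * k * b) * (R * x\<^sup>2 - R' * y\<^sup>2)"
      have split: "imbalance_form R R' x y a k j b * i = ?l x y (a * i) k j (b * i) i (R' * b - R * a)"
        for x y a k j b i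
        unfolding imbalance_form_def by algebra
      have "?h (s + T n) / T n ^ 1
          = ?l (?x n) (?y n) (?a n) (q * ?J n / (2 * p)) (?J n / 2) (?b n) (?i n) (?d n)" for n
      proof -
        have "R' * diag_area q (s + T n) - R * diag_area p (s + T n) = ?d n"
          using p pq by (simp add: R_eq diag_area_def field_simps)
        then show ?thesis
          by (simp only: imbalance_def divide_inverse[of _ "T n"] power_one_right split)
      qed
      moreover have "(\<lambda>n. ?l (?x n) (?y n) (?a n) (q * ?J n / (2 * p)) (?J n / 2) (?b n) (?i n) (?d n))
          \<longlonglongrightarrow> ?l (chord p s) (chord q s) (1 / (4 * p)) (q * mixed_area p q s / (2 * p))
            (mixed_area p q s / 2) (1 / (4 * q)) 0
            (\<rho> * (chord p s * cos (p * s) - chord q s * cos (q * s)) / 4)"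
        using p by (intro tendsto_intros chord_lim mixed_lim diag_lim inv_lim cos_lim) auto
      moreover have "?l (chord p s) (chord q s) (1 / (4 * p)) (q * mixed_area p q s / (2 * p))
            (mixed_area p q s / 2) (1 / (4 * q)) 0
            (\<rho> * (chord p s * cos (p * s) - chord q s * cos (q * s)) / 4) = B s"
      proof -
        have "R' * (1 / (4 * q)) + R * (1 / (4 * p)) = \<rho> / 2"
          "R * (1 / (4 * p)) * (mixed_area p q s / 2) + R' * (q * mixed_area p q s / (2 * p)) * (1 / (4 * q))
            = \<rho> * mixed_area p q s * (p + q) / (8 * p)"
          using p pq by (simp_all add: R_eq field_simps)
        then show ?thesis unfolding B_def by simp
      qed
      ultimately show ?thesis by simp
    qed
    \<comment> \<open>At \<open>pi / p\<close> the first chord vanishes, which leaves a single term of \<open>B\<close>, of known sign.\<close>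
    define s1 where "s1 = pi / p"
    define y where "y = chord q s1"
    have "q * s1 > 0" "q * s1 < pi" using p pq by (auto simp: s1_def field_simps)
    then have y: "y > 0" using pq by (simp add: y_def chord_def sin_gt_zero)
    have at_s1: "chord p s1 = 0" "mixed_area p q s1 = p * y / (p\<^sup>2 - q\<^sup>2)"
      and at_neg: "chord p (- s1) = 0" "mixed_area p q (- s1) = - (p * y / (p\<^sup>2 - q\<^sup>2))" "chord q (- s1) = - y"
      using p pq by (simp_all add: s1_def y_def mixed_area_def chord_def)
    define K where "K = \<rho> * (p * y / (p\<^sup>2 - q\<^sup>2)) * (p + q) / (8 * p) * (R' * y\<^sup>2)"
    have K: "K > 0" using p pq pq2 \<rho> R y by (simp add: K_def)
    have "B s1 = - K" "B (- s1) = K"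
      unfolding B_def at_s1 at_neg y_def[symmetric] K_def by (simp_all add: y_def)
    then show thesis
      using that[OF T pos_if[OF lim, of "- s1"] neg_if[OF lim, of s1]] K by simp
  qed
qed

text \<open>The diagonal areas grow linearly, the mixed ones are bounded. The constant \<open>Q\<close> is chosen so
  that \<open>Q\<^sup>2 / (16 p q)\<close>, a lower bound for the product of the diagonal areas, beats the bound
  \<open>q M\<^sup>2 / (4 p)\<close> for the mixed term.\<close>

lemma area_determinant_eventually_pos:
  assumes pq: "p > q" "q > 0"
  obtains s\<^sub>0 where "\<And>s. s \<ge> s\<^sub>0 \<Longrightarrow>
    diag_area p s * diag_area q s > (q * mixed_area p q s / (2 * p)) * (mixed_area p q s / 2)"
proof -
  have p: "p > 0" using pq by simp
  have pq2: "p\<^sup>2 - q\<^sup>2 > 0" using pq by (simp add: power_strict_mono)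
  define M where "M = (1 + p * (1 / q)) / (p\<^sup>2 - q\<^sup>2)"
  define Q where "Q = 2 * (q * M) + 1"
  have chord_le: "\<bar>chord r s\<bar> \<le> 1 / r" if "r > 0" for r s
    using that by (simp add: chord_def divide_right_mono)
  have M: "\<bar>mixed_area p q s\<bar> \<le> M" for s
  proof -
    have "\<bar>sin (p * s) * cos (q * s) - p * cos (p * s) * chord q s\<bar>
        \<le> \<bar>sin (p * s)\<bar> * \<bar>cos (q * s)\<bar> + p * \<bar>cos (p * s)\<bar> * \<bar>chord q s\<bar>"
      using abs_triangle_ineq4[of "sin (p * s) * cos (q * s)" "p * cos (p * s) * chord q s"] p
      by (simp add: abs_mult)
    also have "\<dots> \<le> 1 * 1 + p * 1 * (1 / q)"
      using p pq chord_le[of q s] by (intro add_mono mult_mono) auto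
    finally show ?thesis using pq2
      by (simp add: mixed_area_def M_def divide_right_mono)
  qed
  have M0: "M \<ge> 0" using M[of 0] by linarith
  then have Q: "Q > 0" using pq by (simp add: Q_def add_nonneg_pos)
  have diag: "diag_area r s \<ge> Q / (4 * r)" if "s \<ge> Q + 1 / q" "r = p \<or> r = q" for r s
  proof -
    have r: "r > 0" "1 / r \<le> 1 / q" using that(2) p pq by (auto simp: field_simps)
    have "\<bar>chord r s * cos (r * s)\<bar> \<le> 1 / r * 1"
      unfolding abs_mult using chord_le[OF r(1)] r(1) by (intro mult_mono) auto
    then have "s - chord r s * cos (r * s) \<ge> Q" using that(1) r(2) by linarith
    then show ?thesis unfolding diag_area_def using r(1) by (intro divide_right_mono) auto
  qed
  show thesis
  proof
    fix s assume s: "s \<ge> Q + 1 / q"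
    have "(q * mixed_area p q s / (2 * p)) * (mixed_area p q s / 2) = q / (4 * p) * \<bar>mixed_area p q s\<bar>\<^sup>2"
      by (simp add: power2_eq_square)
    also have "\<dots> \<le> q / (4 * p) * M\<^sup>2"
      using M[of s] p pq by (intro mult_left_mono power_mono) auto
    also have "\<dots> = (q * M)\<^sup>2 / (4 * p * q)"
      using p pq by (simp add: power2_eq_square)
    also have "\<dots> = (2 * (q * M))\<^sup>2 / (16 * p * q)" by (simp add: power2_eq_square)
    also have "\<dots> < Q\<^sup>2 / (16 * p * q)"
      using p pq M0 by (intro divide_strict_right_mono power_strict_mono) (auto simp: Q_def)
    also have "Q\<^sup>2 / (16 * p * q) = Q / (4 * p) * (Q / (4 * q))" by (simp add: power2_eq_square)
    also have "\<dots> \<le> diag_area p s * diag_area q s"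
      using Q p pq diag[OF s, of p] diag[OF s, of q]
      by (intro mult_mono) (auto intro: order_trans[of 0 "Q / (4 * p)"])
    finally show "diag_area p s * diag_area q s > (q * mixed_area p q s / (2 * p)) * (mixed_area p q s / 2)" .
  qed
qed

text \<open>The determinant condition is independence of the vectors paired with \<open>E\<^sub>1\<close> and \<open>E\<^sub>2\<close>. After
  normalising \<open>E\<^sub>1\<close> and \<open>E\<^sub>2\<close>, the balance condition of \<open>C4_nondegenerate\<close> is \<open>r r'\<close> times the
  imbalance.\<close>

lemma C4_if_imbalance_zero:
  fixes E1 F1 E2 F2 :: "real^4"
  assumes r: "r > 0" "r' > 0"
    and nrm: "E1 \<bullet> E1 = r\<^sup>2" "F1 \<bullet> F1 = r\<^sup>2" "E2 \<bullet> E2 = r'\<^sup>2" "F2 \<bullet> F2 = r'\<^sup>2"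
    and orth: "E1 \<bullet> F1 = 0" "E1 \<bullet> E2 = 0" "E1 \<bullet> F2 = 0" "F1 \<bullet> E2 = 0" "F1 \<bullet> F2 = 0" "E2 \<bullet> F2 = 0"
    and det: "a * b \<noteq> k * j"
    and zero: "imbalance_form (r\<^sup>2) (r'\<^sup>2) x y a k j b = 0"
  shows "(x *\<^sub>R E1 + y *\<^sub>R E2, E1 \<and>\<^sub>w (a *\<^sub>R F1 + k *\<^sub>R F2) + E2 \<and>\<^sub>w (j *\<^sub>R F1 + b *\<^sub>R F2)) \<in> C\<^sub>4"
proof -
  define e1 where "e1 = (1 / r) *\<^sub>R E1"
  define e2 where "e2 = (1 / r') *\<^sub>R E2"
  define w1 where "w1 = r *\<^sub>R (a *\<^sub>R F1 + k *\<^sub>R F2)"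
  define w2 where "w2 = r' *\<^sub>R (j *\<^sub>R F1 + b *\<^sub>R F2)"
  note inn = inner_add_left inner_add_right inner_scaleR_left inner_scaleR_right
  have ww: "w1 \<bullet> w1 = r\<^sup>2 * (r\<^sup>2 * a\<^sup>2 + r'\<^sup>2 * k\<^sup>2)" "w2 \<bullet> w2 = r'\<^sup>2 * (r\<^sup>2 * j\<^sup>2 + r'\<^sup>2 * b\<^sup>2)"
    "w1 \<bullet> w2 = r * r' * (r\<^sup>2 * a * j + r'\<^sup>2 * k * b)"
    using orth by (simp_all add: w1_def w2_def inn nrm inner_commute power2_eq_square algebra_simps)
  have "((r * x) *\<^sub>R e1 + (r' * y) *\<^sub>R e2, e1 \<and>\<^sub>w w1 + e2 \<and>\<^sub>w w2) \<in> C\<^sub>4"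
  proof (rule C4_nondegenerate)
    show "e1 \<bullet> e1 = 1" "e2 \<bullet> e2 = 1" "e1 \<bullet> e2 = 0" "e1 \<bullet> w1 = 0" "e1 \<bullet> w2 = 0" "e2 \<bullet> w1 = 0" "e2 \<bullet> w2 = 0"
      using r orth by (simp_all add: e1_def e2_def w1_def w2_def inn nrm inner_commute power2_eq_square)
    have "r * x * (r' * y) * (w2 \<bullet> w2 - w1 \<bullet> w1) + w1 \<bullet> w2 * ((r * x)\<^sup>2 - (r' * y)\<^sup>2)
        = r * r' * imbalance_form (r\<^sup>2) (r'\<^sup>2) x y a k j b"
      unfolding ww imbalance_form_def by algebra
    then show "r * x * (r' * y) * (w2 \<bullet> w2 - w1 \<bullet> w1) + w1 \<bullet> w2 * ((r * x)\<^sup>2 - (r' * y)\<^sup>2) = 0"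
      using zero by simp
  next
    fix c d assume "c *\<^sub>R w1 + d *\<^sub>R w2 = 0"
    then have "(c *\<^sub>R w1 + d *\<^sub>R w2) \<bullet> F1 = 0" "(c *\<^sub>R w1 + d *\<^sub>R w2) \<bullet> F2 = 0" by simp_all
    moreover have "(c *\<^sub>R w1 + d *\<^sub>R w2) \<bullet> F1 = r\<^sup>2 * ((c * r) * a + (d * r') * j)"
      "(c *\<^sub>R w1 + d *\<^sub>R w2) \<bullet> F2 = r'\<^sup>2 * ((c * r) * k + (d * r') * b)"
      using orth by (simp_all add: w1_def w2_def inn nrm inner_commute algebra_simps)
    ultimately have "(c * r) * a + (d * r') * j = 0" "(c * r) * k + (d * r') * b = 0"
      using r by simp_all
    then have "(c * r) * (a * b - k * j) = 0" "(d * r') * (a * b - k * j) = 0" by algebra+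
    then show "c = 0 \<and> d = 0" using det r by simp
  qed
  then show ?thesis
    using r by (simp add: e1_def e2_def w1_def w2_def wedge_scaleR_left wedge_scaleR_right)
qed

section \<open>The case of a zero frequency\<close>

lemma C4_if_displacement_orthogonal:
  fixes E1 F1 E2 F2 :: "real^4"
  assumes r: "r > 0" "r' > 0"
    and nrm: "E1 \<bullet> E1 = r\<^sup>2" "F1 \<bullet> F1 = r\<^sup>2" "E2 \<bullet> E2 = r'\<^sup>2" "F2 \<bullet> F2 = r'\<^sup>2"
    and orth: "E1 \<bullet> F1 = 0" "E1 \<bullet> E2 = 0" "E1 \<bullet> F2 = 0" "F1 \<bullet> E2 = 0" "F1 \<bullet> F2 = 0" "E2 \<bullet> F2 = 0"
    and a: "a \<noteq> 0"
    and zero: "r\<^sup>2 * (x * a) + r'\<^sup>2 * (y * j) = 0"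
  shows "(x *\<^sub>R E1 + y *\<^sub>R E2, E1 \<and>\<^sub>w (a *\<^sub>R F1) + E2 \<and>\<^sub>w (j *\<^sub>R F1)) \<in> C\<^sub>4"
proof -
  have "((r * x) *\<^sub>R ((1 / r) *\<^sub>R E1) + (r' * y) *\<^sub>R ((1 / r') *\<^sub>R E2),
      ((r\<^sup>2 * a) *\<^sub>R ((1 / r) *\<^sub>R E1) + (r * r' * j) *\<^sub>R ((1 / r') *\<^sub>R E2)) \<and>\<^sub>w ((1 / r) *\<^sub>R F1)) \<in> C\<^sub>4"
  proof (rule C4_degenerate[where ?f2.0 = "(1 / r') *\<^sub>R F2"])
    have "r * x * (r\<^sup>2 * a) + r' * y * (r * r' * j) = r * (r\<^sup>2 * (x * a) + r'\<^sup>2 * (y * j))"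
      by algebra
    then show "r * x * (r\<^sup>2 * a) + r' * y * (r * r' * j) = 0" using zero by simp
  qed (use r a nrm orth in \<open>simp_all add: inner_commute power2_eq_square\<close>)
  moreover have "((r\<^sup>2 * a) *\<^sub>R ((1 / r) *\<^sub>R E1) + (r * r' * j) *\<^sub>R ((1 / r') *\<^sub>R E2)) \<and>\<^sub>w ((1 / r) *\<^sub>R F1)
      = E1 \<and>\<^sub>w (a *\<^sub>R F1) + E2 \<and>\<^sub>w (j *\<^sub>R F1)"
    using r by (simp add: vec_eq_iff wedge_nth field_simps power2_eq_square)
  ultimately show ?thesis using r by simp
qed

text \<open>When \<open>sin (p s) = 0\<close>, the expression reduces to \<open>- R' s\<^sup>2 cos (p s) / (2 p)\<close>, which alternates
  in sign along the positive multiples of \<open>pi / p\<close>.\<close>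

lemma zero_frequency_orthogonal_times:
  assumes p: "p > 0" and R: "R' > 0"
  shows "\<exists>s\<ge>N. diag_area p s \<noteq> 0 \<and>
    R * (chord p s * diag_area p s) + R' * (chord 0 s * (mixed_area p 0 s / 2)) = 0"
proof -
  define h where "h s = R * (chord p s * diag_area p s) + R' * (chord 0 s * (mixed_area p 0 s / 2))" for s
  define T where "T n = 2 * pi / p * real n" for n
  have T: "filterlim T at_top sequentially"
    unfolding T_def using p
    by (intro filterlim_tendsto_pos_mult_at_top[OF tendsto_const _ filterlim_real_sequentially]) simp
  have T0: "eventually (\<lambda>n. T n > 0) sequentially"
    using T by (simp add: filterlim_at_top_dense)
  have cont: "continuous_on UNIV h"
    unfolding h_def[abs_def]
    by (intro continuous_intros continuous_on_chord continuous_on_diag_area continuous_on_mixed_area) simp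
  have h_eq: "h s = - (R' * (s\<^sup>2 * cos (p * s)) / (2 * p))" if "sin (p * s) = 0" for s
    using that p by (simp add: h_def chord_def mixed_area_def power2_eq_square mult_ac)
  have pT: "p * T n = 2 * pi * real n" for n using p by (simp add: T_def)
  have trig: "sin (p * (pi / p + T n)) = 0" "cos (p * (pi / p + T n)) = - 1"
    "sin (p * (0 + T n)) = 0" "cos (p * (0 + T n)) = 1" for n
    using p sin_2npi[of n] cos_2npi[of n]
    by (simp_all add: distrib_left pT sin_add cos_add mult.commute mult.left_commute)
  have "eventually (\<lambda>n. h (pi / p + T n) > 0) sequentially"
    using T0 by eventually_elim (use p R in \<open>auto simp: h_eq[OF trig(1)] trig(2) add_pos_pos less_imp_neq[symmetric]\<close>)
  moreover have "eventually (\<lambda>n. h (0 + T n) < 0) sequentially"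
    using T0 by eventually_elim (use p R h_eq[OF trig(3)] trig(4) in auto)
  ultimately obtain s where s: "s \<ge> max N (1 / p + 1)" "h s = 0"
    using zero_beyond_if_changes_sign[OF cont T] by blast
  have "\<bar>chord p s * cos (p * s)\<bar> \<le> 1 / p * 1"
    unfolding abs_mult using p by (intro mult_mono) (auto simp: chord_def divide_right_mono)
  then have "diag_area p s > 0"
    using s(1) p by (auto simp: diag_area_def)
  then show ?thesis using s by (intro exI[of _ s]) (auto simp: h_def)
qed

section \<open>The trajectory meets the set at arbitrarily large times\<close>

lemma moving_frame_inner:
  assumes "a \<bullet> a = R" "b \<bullet> b = R" "a \<bullet> b = 0"
  shows "radial p a b s \<bullet> radial p a b s = R" "tangential p a b s \<bullet> tangential p a b s = R"
    "radial p a b s \<bullet> tangential p a b s = 0"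
proof -
  define c d where "c = cos (p * s)" and "d = sin (p * s)"
  have cd: "c * c + d * d = 1"
    using sin_cos_squared_add3[of "p * s"] by (simp add: c_def d_def)
  have "radial p a b s \<bullet> radial p a b s = (c * c + d * d) * R"
    "tangential p a b s \<bullet> tangential p a b s = (c * c + d * d) * R"
    "radial p a b s \<bullet> tangential p a b s = 0"
    unfolding radial_def tangential_def c_def[symmetric] d_def[symmetric]
    using assms by (simp_all add: inner_add_left inner_add_right
        inner_diff_left inner_diff_right inner_commute[of b a] algebra_simps)
  then show "radial p a b s \<bullet> radial p a b s = R" "tangential p a b s \<bullet> tangential p a b s = R"
    "radial p a b s \<bullet> tangential p a b s = 0" by (simp_all add: cd)
qed

lemma moving_frames_orthogonal:
  assumes "a \<bullet> c = 0" "a \<bullet> d = 0" "b \<bullet> c = 0" "b \<bullet> d = 0"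
  shows "radial p a b s \<bullet> radial q c d s = 0" "radial p a b s \<bullet> tangential q c d s = 0"
    "tangential p a b s \<bullet> radial q c d s = 0" "tangential p a b s \<bullet> tangential q c d s = 0"
  using assms by (simp_all add: radial_def tangential_def inner_add_left inner_add_right
      inner_diff_left inner_diff_right)

theorem theorem1p4:
  fixes a b :: "nat \<Rightarrow> real^4" and r \<phi> :: "nat \<Rightarrow> real"
    and \<gamma> :: "real \<Rightarrow> (real^4) \<times> (real^4^4)"
  assumes "orthogonal (a 1) (b 1)" "orthogonal (a 1) (a 2)" "orthogonal (a 1) (b 2)"
    and "orthogonal (b 1) (a 2)" "orthogonal (b 1) (b 2)" "orthogonal (a 2) (b 2)"
    and "\<forall>k\<in>{1..2}. norm (a k) = r k \<and> norm (b k) = r k \<and> r k > 0"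
    and "\<phi> 1 > \<phi> 2" "\<phi> 2 \<ge> 0"
    and "trajectory (control a b \<phi>) \<gamma>"
  shows "\<exists>s :: nat \<Rightarrow> real. filterlim s at_top sequentially \<and> (\<forall>j. \<gamma> (s j) \<in> C\<^sub>4)"
proof -
  define p where "p = \<phi> 1"
  define q where "q = \<phi> 2"
  have p: "p > 0" and pq: "p > q" using assms(8,9) by (auto simp: p_def q_def)
  have r: "r 1 > 0" "r 2 > 0" using assms(7) by auto
  have n: "a 1 \<bullet> a 1 = (r 1)\<^sup>2" "b 1 \<bullet> b 1 = (r 1)\<^sup>2" "a 2 \<bullet> a 2 = (r 2)\<^sup>2" "b 2 \<bullet> b 2 = (r 2)\<^sup>2"
    using assms(7) by (simp_all add: dot_square_norm)
  note o = assms(1-6)[unfolded orthogonal_def]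
  note frame = moving_frame_inner[OF n(1,2) o(1)] moving_frame_inner[OF n(3,4) o(6)]
    moving_frames_orthogonal[OF o(2-5)]
  note \<gamma> = trajectory_control_eq[OF assms(8,9,10), folded p_def q_def]
  have hit: "\<exists>s\<ge>N. \<gamma> s \<in> C\<^sub>4" for N
  proof (cases "q = 0")
    case True
    obtain s where s: "s \<ge> N" "diag_area p s \<noteq> 0"
      "(r 1)\<^sup>2 * (chord p s * diag_area p s) + (r 2)\<^sup>2 * (chord q s * (mixed_area p q s / 2)) = 0"
      using zero_frequency_orthogonal_times[OF p, of "(r 2)\<^sup>2" N "(r 1)\<^sup>2"] r True by auto
    have "diag_area q s = 0" using True by (simp add: diag_area_def)
    then have "\<gamma> s \<in> C\<^sub>4"
      using C4_if_displacement_orthogonal[OF r frame(1,2,4,5,3,7,8,9,10,6) s(2,3)]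
      by (simp add: \<gamma> True)
    then show ?thesis using s(1) by blast
  next
    case False
    then have q: "q > 0" using assms(9) by (simp add: q_def)
    obtain s\<^sub>0 where s\<^sub>0: "\<And>s. s \<ge> s\<^sub>0 \<Longrightarrow> diag_area p s * diag_area q s
        > (q * mixed_area p q s / (2 * p)) * (mixed_area p q s / 2)"
      using area_determinant_eventually_pos[OF pq q] by blast
    obtain T s\<^sub>1 s\<^sub>2 where "filterlim T at_top sequentially"
      "eventually (\<lambda>n. imbalance ((r 1)\<^sup>2) ((r 2)\<^sup>2) p q (s\<^sub>1 + T n) > 0) sequentially"
      "eventually (\<lambda>n. imbalance ((r 1)\<^sup>2) ((r 2)\<^sup>2) p q (s\<^sub>2 + T n) < 0) sequentially"
      using imbalance_changes_sign[OF pq q, of "(r 1)\<^sup>2" "(r 2)\<^sup>2"] r by auto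
    then obtain s where s: "s \<ge> max N s\<^sub>0" "imbalance ((r 1)\<^sup>2) ((r 2)\<^sup>2) p q s = 0"
      using zero_beyond_if_changes_sign[OF continuous_on_imbalance] by blast
    have "\<gamma> s \<in> C\<^sub>4"
      unfolding \<gamma> using s s\<^sub>0[of s]
      by (intro C4_if_imbalance_zero[OF r frame(1,2,4,5,3,7,8,9,10,6)]) (auto simp: imbalance_def)
    then show ?thesis using s(1) by auto
  qed
  then have "\<forall>j. \<exists>s. s \<ge> real j \<and> \<gamma> s \<in> C\<^sub>4" by blast
  then obtain s where s: "\<And>j::nat. s j \<ge> real j \<and> \<gamma> (s j) \<in> C\<^sub>4" by metis
  then have "filterlim s at_top sequentially"
    by (intro filterlim_at_top_mono[OF filterlim_real_sequentially]) (auto intro: always_eventually)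
  then show ?thesis using s by blast
qed

end
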